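(* Let $m,k,n$ be positive integers. The set $SAT(\mathbb{Z}^m,k,n)\subset\mathbb{Z}^{n(k+m)}$ is negligible (i.e. has asymptotic density $0$) if $n>k$.
   Context: A system of $n$ equations in $k$ variables over the free abelian group $\mathbb{Z}^m$ is written $AX=B$ with $A\in\mathbb{Z}^{n\times k}$, $B\in\mathbb{Z}^{n\times m}$, and is identified with the integer matrix $(A|B)\in\mathbb{Z}^{n(k+m)}$. It is solvable in $\mathbb{Z}^m$ if there is $X\in\mathbb{Z}^{k\times m}$ with $AX=B$. $SAT(\mathbb{Z}^m,k,n)\subset\mathbb{Z}^{n(k+m)}$ is the set of all $(A|B)$ such that $AX=B$ is solvable in $\mathbb{Z}^m$. For a positive integer $N$ let $\|v\|_\infty=\max_i|v_i|$ and $B_r^N=\{v\in\mathbb{Z}^N:\|v\|_\infty\le r\}$. For $M\subset\mathbb{Z}^N$ the asymptotic density is $\rho(M)=\lim_{r\to\infty}|M\cap B_r^N|/|B_r^N|$ when the limit exists; $M$ is negligible if $\rho(M)=0$. *)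

theory Defs
  imports Complex_Main "Jordan_Normal_Form.Matrix"
begin

section \<open>Asymptotic density in \<open>\<int>\<^sup>N\<close>\<close>

text \<open>Only meant for vectors of positive dimension (otherwise it is the maximum of the empty set).\<close>

definition sup_norm :: "int vec \<Rightarrow> int" where
  "sup_norm v = Max {\<bar>v $ i\<bar> | i. i < dim_vec v}"

definition int_ball :: "nat \<Rightarrow> nat \<Rightarrow> int vec set" where
  "int_ball N r = {v \<in> carrier_vec N. sup_norm v \<le> int r}"

text \<open>The density is a partial notion, so it is rendered as a relation: \<open>M\<close> has density \<open>d\<close>
  if the defining limit exists and equals \<open>d\<close>. As \<open>sup_norm\<close> is integer-valued, letting \<open>r\<close> range
  over the natural numbers or over the reals makes no difference.\<close>

definition has_density :: "nat \<Rightarrow> int vec set \<Rightarrow> real \<Rightarrow> bool" where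
  "has_density N M d \<longleftrightarrow>
     (\<lambda>r. real (card (M \<inter> int_ball N r)) / real (card (int_ball N r))) \<longlonglongrightarrow> d"

definition asymp_negligible :: "nat \<Rightarrow> int vec set \<Rightarrow> bool" where
  "asymp_negligible N M \<longleftrightarrow> has_density N M 0"

lemma int_ball_altdef:
  assumes "N > 0"
  shows "int_ball N r = {v \<in> carrier_vec N. \<forall>i<N. \<bar>v $ i\<bar> \<le> int r}"
proof -
  have "sup_norm v \<le> int r \<longleftrightarrow> (\<forall>i<N. \<bar>v $ i\<bar> \<le> int r)" if "v \<in> carrier_vec N" for v
  proof -
    have d: "dim_vec v = N" using that by auto
    have "{\<bar>v $ i\<bar> | i. i < N} = (\<lambda>i. \<bar>v $ i\<bar>) ` {..<N}" by auto
    moreover have "(\<lambda>i. \<bar>v $ i\<bar>) ` {..<N} \<noteq> {}" using assms by auto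
    ultimately show ?thesis unfolding sup_norm_def d by (auto simp: Max_le_iff)
  qed
  then show ?thesis unfolding int_ball_def by auto
qed


section \<open>Systems of equations over \<open>\<int>\<^sup>m\<close>\<close>

text \<open>The \<open>i\<close>-th row of \<open>X\<close> is the value in \<open>\<int>\<^sup>m\<close> of the \<open>i\<close>-th variable.\<close>

definition system_solvable :: "nat \<Rightarrow> nat \<Rightarrow> int mat \<Rightarrow> int mat \<Rightarrow> bool" where
  "system_solvable m k A B \<longleftrightarrow> (\<exists>X \<in> carrier_mat k m. A * X = B)"

definition augmented :: "int mat \<Rightarrow> int mat \<Rightarrow> int mat" where
  "augmented A B = four_block_mat A B (0\<^sub>m 0 (dim_col A)) (0\<^sub>m 0 (dim_col B))"

text \<open>The identification of \<open>p \<times> q\<close> integer matrices with \<open>\<int>\<^sup>p\<^sup>q\<close>, row after row.\<close>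

definition vec_of_mat :: "int mat \<Rightarrow> int vec" where
  "vec_of_mat M = vec (dim_row M * dim_col M) (\<lambda>l. M $$ (l div dim_col M, l mod dim_col M))"

definition SAT :: "nat \<Rightarrow> nat \<Rightarrow> nat \<Rightarrow> int vec set" where
  "SAT m k n = {vec_of_mat (augmented A B) | A B.
     A \<in> carrier_mat n k \<and> B \<in> carrier_mat n m \<and> system_solvable m k A B}"

lemma bij_betw_vec_of_mat: "bij_betw vec_of_mat (carrier_mat p q) (carrier_vec (p * q))"
proof (rule bij_betw_byWitness[where f' = "\<lambda>v. mat p q (\<lambda>(i, j). v $ (i * q + j))"])
  have "i * q + j < p * q" if "i < p" "j < q" for i j
  proof -
    have "i * q + j < (i + 1) * q" using that by simp
    also have "\<dots> \<le> p * q" using that by (intro mult_right_mono) auto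
    finally show ?thesis .
  qed
  then show "\<forall>M\<in>carrier_mat p q. mat p q (\<lambda>(i, j). vec_of_mat M $ (i * q + j)) = M"
    by (auto simp: vec_of_mat_def intro!: eq_matI)
  have "l div q < p \<and> l mod q < q" if "l < p * q" for l
    using that by (cases "q = 0") (auto simp: less_mult_imp_div_less)
  then show "\<forall>v\<in>carrier_vec (p * q). vec_of_mat (mat p q (\<lambda>(i, j). v $ (i * q + j))) = v"
    by (auto simp: vec_of_mat_def intro!: eq_vecI)
qed (auto simp: vec_of_mat_def)

lemma SAT_subset: "SAT m k n \<subseteq> carrier_vec (n * (k + m))"
  by (auto simp: SAT_def augmented_def vec_of_mat_def)

end

theory Submission
  imports Defs "Jordan_Normal_Form.Determinant"
begin

text \<open>
  A system with more equations than variables has a linear dependency among the rows of its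
  coefficient matrix \<open>A\<close>: some nonzero integer vector \<open>c\<close> satisfies \<open>c\<^sup>T A = 0\<close>
  (\<open>ex_left_annihilator\<close>). Any right-hand side \<open>B = A X\<close> must then satisfy
  \<open>c\<^sup>T B = 0\<close> as well. If \<open>c\<^sub>i \<noteq> 0\<close>, then \<open>A\<close> and the other
  entries in the first column of \<open>B\<close> determine the entry in row \<open>i\<close> of that column. So \<open>SAT\<close> is
  the union of \<open>n\<close> sets, one for each \<open>i\<close>, and in the \<open>i\<close>-th set one fixed coordinate is a function of the others
  (\<open>coord_determined_SAT_part\<close>).

  Such a set contains at most a fraction \<open>1 / (2 r + 1)\<close> of the ball of radius \<open>r\<close>, since the
  determined coordinate can be overwritten freely by any of \<open>2 r + 1\<close> values without two results
  ever coinciding (\<open>card_coord_determined\<close>). The \<open>n\<close> sets together contain at most a fraction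
  \<open>n / (2 r + 1)\<close>, which tends to \<open>0\<close>.
\<close>

section \<open>Sets in which one coordinate is a function of the others\<close>

definition coord_determined :: "nat \<Rightarrow> 'a vec set \<Rightarrow> bool" where
  "coord_determined p S \<longleftrightarrow>
     (\<forall>v\<in>S. \<forall>w\<in>S. (\<forall>l<dim_vec v. l \<noteq> p \<longrightarrow> v $ l = w $ l) \<longrightarrow> v = w)"

lemma finite_int_ball:
  assumes "N > 0"
  shows "finite (int_ball N r)"
proof (rule finite_subset)
  show "int_ball N r \<subseteq> vec_of_list ` {xs. set xs \<subseteq> {- int r..int r} \<and> length xs = N}"
  proof
    fix v assume v: "v \<in> int_ball N r"
    then have "set (list_of_vec v) \<subseteq> {- int r..int r}" "length (list_of_vec v) = N"
      by (auto simp: int_ball_altdef[OF assms] in_set_conv_nth abs_le_iff list_of_vec_index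
          minus_le_iff)
    then show "v \<in> vec_of_list ` {xs. set xs \<subseteq> {- int r..int r} \<and> length xs = N}"
      by (intro image_eqI[of _ _ "list_of_vec v"]) (auto simp: vec_list)
  qed
qed (simp add: finite_lists_length_eq)

lemma card_int_ball_pos:
  assumes "N > 0"
  shows "card (int_ball N r) > 0"
proof -
  have "0\<^sub>v N \<in> int_ball N r"
    by (auto simp: int_ball_altdef[OF assms])
  then show ?thesis
    using finite_int_ball[OF assms] by (auto simp: card_gt_0_iff)
qed

text \<open>Overwriting the determined coordinate \<open>p\<close> of \<open>v\<close> by \<open>t\<close> loses nothing: the result shows \<open>t\<close>
  at \<open>p\<close> and all other coordinates of \<open>v\<close>, and these determine \<open>v\<close>. Inside the ball there are
  \<open>2 r + 1\<close> choices of \<open>t\<close>.\<close>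

lemma card_coord_determined:
  assumes p: "p < N" and S: "S \<subseteq> carrier_vec N" and det: "coord_determined p S"
  shows "card (S \<inter> int_ball N r) * (2 * r + 1) \<le> card (int_ball N r)"
proof -
  from p have N: "N > 0" by simp
  define f :: "int vec \<times> int \<Rightarrow> int vec"
    where "f = (\<lambda>(v, t). vec N (\<lambda>l. if l = p then t else v $ l))"
  have "inj_on f ((S \<inter> int_ball N r) \<times> {- int r..int r})"
  proof (rule inj_onI, clarify)
    fix v t w u
    assume vw: "v \<in> S" "w \<in> S" and eq: "f (v, t) = f (w, u)"
    have idx: "(if l = p then t else v $ l) = (if l = p then u else w $ l)" if "l < N" for l
      using arg_cong[OF eq, of "\<lambda>x. x $ l"] that by (simp add: f_def)
    have "\<forall>l<dim_vec v. l \<noteq> p \<longrightarrow> v $ l = w $ l"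
      using idx vw S by (metis carrier_vecD subsetD)
    then show "v = w \<and> t = u"
      using det vw idx[OF p] by (simp add: coord_determined_def)
  qed
  moreover have "f ` ((S \<inter> int_ball N r) \<times> {- int r..int r}) \<subseteq> int_ball N r"
    by (auto simp: f_def int_ball_altdef[OF N])
  ultimately have "card ((S \<inter> int_ball N r) \<times> {- int r..int r}) \<le> card (int_ball N r)"
    using finite_int_ball[OF N] by (rule card_inj_on_le)
  moreover have "card {- int r..int r} = 2 * r + 1"
    by simp
  ultimately show ?thesis
    by (simp only: card_cartesian_product)
qed

lemma asymp_negligible_Union_coord_determined:
  fixes S :: "'i \<Rightarrow> int vec set"
  assumes N: "N > 0" and I: "finite I" and M: "M \<subseteq> (\<Union>i\<in>I. S i)"
    and p: "\<And>i. i \<in> I \<Longrightarrow> p i < N"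
    and S: "\<And>i. i \<in> I \<Longrightarrow> S i \<subseteq> carrier_vec N"
    and det: "\<And>i. i \<in> I \<Longrightarrow> coord_determined (p i) (S i)"
  shows "asymp_negligible N M"
proof -
  let ?q = "\<lambda>r. real (card (M \<inter> int_ball N r)) / real (card (int_ball N r))"
  have "?q r \<le> real (card I) / real (2 * r + 1)" for r
  proof -
    have "card (M \<inter> int_ball N r) \<le> card (\<Union>i\<in>I. S i \<inter> int_ball N r)"
      using M I finite_int_ball[OF N] by (intro card_mono) auto
    also have "\<dots> \<le> (\<Sum>i\<in>I. card (S i \<inter> int_ball N r))"
      using I by (rule card_UN_le)
    finally have "card (M \<inter> int_ball N r) * (2 * r + 1)
        \<le> (\<Sum>i\<in>I. card (S i \<inter> int_ball N r)) * (2 * r + 1)"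
      by (rule mult_le_mono1)
    also have "\<dots> = (\<Sum>i\<in>I. card (S i \<inter> int_ball N r) * (2 * r + 1))"
      by (rule sum_distrib_right)
    also have "\<dots> \<le> (\<Sum>i\<in>I. card (int_ball N r))"
      using p S det by (intro sum_mono card_coord_determined)
    also have "\<dots> = card I * card (int_ball N r)"
      by simp
    finally have "real (card (M \<inter> int_ball N r)) * real (2 * r + 1)
        \<le> real (card I) * real (card (int_ball N r))"
      by (simp only: of_nat_mult[symmetric] of_nat_le_iff)
    then show ?thesis
      using card_int_ball_pos[OF N, of r] by (simp add: divide_simps mult.commute)
  qed
  moreover have "(\<lambda>r. real (card I) / real (2 * r + 1)) \<longlonglongrightarrow> 0"
  proof (rule tendsto_divide_0[OF tendsto_const])
    have "filterlim (\<lambda>r::nat. 2 * r + 1) at_top sequentially"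
      by (rule filterlim_subseq) (simp add: strict_mono_def)
    then show "filterlim (\<lambda>r. real (2 * r + 1)) at_infinity sequentially"
      by (intro filterlim_at_top_imp_at_infinity
          filterlim_compose[OF filterlim_real_sequentially])
  qed
  ultimately have "?q \<longlonglongrightarrow> 0"
    by (intro tendsto_sandwich[of "\<lambda>_. 0" ?q]) auto
  then show ?thesis
    by (simp add: asymp_negligible_def has_density_def)
qed

section \<open>Linear dependencies between the equations of a system\<close>

text \<open>Padding \<open>A\<^sup>T\<close> with zero rows makes it a square matrix of determinant \<open>0\<close>, and over an
  integral domain such a matrix has a nonzero kernel vector. The rows that were added impose no
  condition on this vector.\<close>

lemma ex_left_annihilator:
  fixes A :: "'a :: idom mat"
  assumes A: "A \<in> carrier_mat n k" and "k < n"
  obtains c where "c \<in> carrier_vec n" "c \<noteq> 0\<^sub>v n" "A\<^sup>T *\<^sub>v c = 0\<^sub>v k"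
proof -
  define P where "P = mat n n (\<lambda>(i, j). if i < k then A $$ (j, i) else 0)"
  have P: "P \<in> carrier_mat n n"
    by (simp add: P_def)
  have "det P = (\<Sum>j<n. P $$ (k, j) * cofactor P k j)"
    using P \<open>k < n\<close> by (rule laplace_expansion_row)
  also have "\<dots> = 0"
    using \<open>k < n\<close> by (simp add: P_def)
  finally obtain c where c: "c \<in> carrier_vec n" "c \<noteq> 0\<^sub>v n" and Pc: "P *\<^sub>v c = 0\<^sub>v n"
    using det_0_iff_vec_prod_zero[OF P] by blast
  have "A\<^sup>T *\<^sub>v c = 0\<^sub>v k"
  proof (rule eq_vecI)
    fix i assume i: "i < dim_vec (0\<^sub>v k :: 'a vec)"
    then have "row A\<^sup>T i = row P i"
      using A \<open>k < n\<close> by (auto simp: P_def)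
    then show "(A\<^sup>T *\<^sub>v c) $ i = 0\<^sub>v k $ i"
      using arg_cong[OF Pc, of "\<lambda>x. x $ i"] i A P \<open>k < n\<close> by simp
  qed (use A in simp)
  with c show thesis by (rule that)
qed

lemma solvable_left_annihilator:
  assumes A: "A \<in> carrier_mat n k" and c: "c \<in> carrier_vec n" "A\<^sup>T *\<^sub>v c = 0\<^sub>v k"
    and "system_solvable m k A B"
  shows "B\<^sup>T *\<^sub>v c = 0\<^sub>v m"
proof -
  from assms(4) obtain X where X: "X \<in> carrier_mat k m" and B: "B = A * X"
    by (auto simp: system_solvable_def)
  have "B\<^sup>T *\<^sub>v c = (X\<^sup>T * A\<^sup>T) *\<^sub>v c"
    using A X by (simp add: B transpose_mult)
  also have "\<dots> = X\<^sup>T *\<^sub>v (A\<^sup>T *\<^sub>v c)"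
    using A X c by (intro assoc_mult_mat_vec) auto
  also have "\<dots> = 0\<^sub>v m"
    using X c by (auto intro!: eq_vecI simp: scalar_prod_def)
  finally show ?thesis .
qed

lemma index_vec_of_augmented:
  assumes "A \<in> carrier_mat n k" "B \<in> carrier_mat n m" "i < n" "j < k + m"
  shows "i * (k + m) + j < n * (k + m)"
    and "vec_of_mat (augmented A B) $ (i * (k + m) + j)
           = (if j < k then A $$ (i, j) else B $$ (i, j - k))"
proof -
  have "i * (k + m) + j < (i + 1) * (k + m)"
    using assms by simp
  also have "\<dots> \<le> n * (k + m)"
    using assms by (intro mult_right_mono) auto
  finally show less: "i * (k + m) + j < n * (k + m)" .
  have "(i * q + j) div q = i" "(i * q + j) mod q = j" if "j < q" for q
    using that by auto
  from this[OF assms(4)] show "vec_of_mat (augmented A B) $ (i * (k + m) + j)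
      = (if j < k then A $$ (i, j) else B $$ (i, j - k))"
    using assms less by (auto simp: vec_of_mat_def augmented_def)
qed

text \<open>The dependency \<open>c\<close> varies with the system. Only the index \<open>i\<close> is fixed, so that the
  determined coordinate is at the same position throughout the set.\<close>

definition SAT_part :: "nat \<Rightarrow> nat \<Rightarrow> nat \<Rightarrow> nat \<Rightarrow> int vec set" where
  "SAT_part m k n i = {vec_of_mat (augmented A B) | A B.
     A \<in> carrier_mat n k \<and> B \<in> carrier_mat n m \<and> system_solvable m k A B \<and>
     (\<exists>c\<in>carrier_vec n. A\<^sup>T *\<^sub>v c = 0\<^sub>v k \<and> c $ i \<noteq> 0)}"

lemma SAT_part_subset: "SAT_part m k n i \<subseteq> carrier_vec (n * (k + m))"
  using SAT_subset[of m k n] by (auto simp: SAT_part_def SAT_def)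

lemma SAT_subset_Union_SAT_part:
  assumes "k < n"
  shows "SAT m k n \<subseteq> (\<Union>i<n. SAT_part m k n i)"
proof
  fix v assume "v \<in> SAT m k n"
  then obtain A B where AB: "v = vec_of_mat (augmented A B)" "A \<in> carrier_mat n k"
    "B \<in> carrier_mat n m" "system_solvable m k A B"
    by (auto simp: SAT_def)
  obtain c where c: "c \<in> carrier_vec n" "c \<noteq> 0\<^sub>v n" "A\<^sup>T *\<^sub>v c = 0\<^sub>v k"
    using ex_left_annihilator[OF AB(2) assms] .
  then obtain i where "i < n" "c $ i \<noteq> 0"
    by (metis carrier_vecD eq_vecI index_zero_vec)
  with AB c show "v \<in> (\<Union>i<n. SAT_part m k n i)"
    by (auto simp: SAT_part_def)
qed

text \<open>The position \<open>i * (k + m) + k\<close> is that of the entry in row \<open>i\<close> of the first column of \<open>B\<close>.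
  Two systems that agree elsewhere have the same coefficient matrix, so the same dependency \<open>c\<close>
  kills both right-hand sides, and \<open>c\<^sub>i \<noteq> 0\<close> forces the remaining entries to agree.\<close>

lemma coord_determined_SAT_part:
  assumes "m > 0" and i: "i < n"
  shows "coord_determined (i * (k + m) + k) (SAT_part m k n i)"
  unfolding coord_determined_def
proof (intro ballI impI)
  fix v w
  assume v: "v \<in> SAT_part m k n i" and w: "w \<in> SAT_part m k n i"
    and agree: "\<forall>l<dim_vec v. l \<noteq> i * (k + m) + k \<longrightarrow> v $ l = w $ l"
  from v obtain A B c where AB: "v = vec_of_mat (augmented A B)" "A \<in> carrier_mat n k"
    "B \<in> carrier_mat n m" "system_solvable m k A B"
    and c: "c \<in> carrier_vec n" "A\<^sup>T *\<^sub>v c = 0\<^sub>v k" "c $ i \<noteq> 0"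
    by (auto simp: SAT_part_def)
  from w obtain A' B' where AB': "w = vec_of_mat (augmented A' B')" "A' \<in> carrier_mat n k"
    "B' \<in> carrier_mat n m" "system_solvable m k A' B'"
    by (auto simp: SAT_part_def)
  have dim: "dim_vec v = n * (k + m)"
    using v SAT_part_subset[of m k n i] by (meson carrier_vecD subsetD)
  have entry: "(if j < k then A $$ (h, j) else B $$ (h, j - k))
      = (if j < k then A' $$ (h, j) else B' $$ (h, j - k))"
    if "h < n" "j < k + m" "(h, j) \<noteq> (i, k)" for h j
  proof -
    have "h * (k + m) + j \<noteq> i * (k + m) + k"
    proof
      assume eq: "h * (k + m) + j = i * (k + m) + k"
      have "h = i" "j = k"
        using arg_cong[OF eq, of "\<lambda>x. x div (k + m)"] arg_cong[OF eq, of "\<lambda>x. x mod (k + m)"]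
          that \<open>m > 0\<close> by auto
      with that show False by simp
    qed
    then have "v $ (h * (k + m) + j) = w $ (h * (k + m) + j)"
      using agree index_vec_of_augmented(1)[OF AB(2,3) that(1,2)] dim by simp
    then show ?thesis
      unfolding AB(1) AB'(1)
      using index_vec_of_augmented(2)[OF AB(2,3) that(1,2)]
        index_vec_of_augmented(2)[OF AB'(2,3) that(1,2)] by simp
  qed
  have A: "A = A'"
  proof (rule eq_matI)
    fix h j assume "h < dim_row A'" "j < dim_col A'"
    then show "A $$ (h, j) = A' $$ (h, j)"
      using entry[of h j] AB'(2) by simp
  qed (use AB AB' in auto)
  have offpos: "B $$ (h, j) = B' $$ (h, j)" if "h < n" "j < m" "(h, j) \<noteq> (i, 0)" for h j
    using entry[of h "k + j"] that by simp
  have "B\<^sup>T *\<^sub>v c = 0\<^sub>v m" "B'\<^sup>T *\<^sub>v c = 0\<^sub>v m"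
    using solvable_left_annihilator[OF AB(2) c(1,2)] AB(4) AB'(4) A by auto
  then have "col B 0 \<bullet> c = 0" "col B' 0 \<bullet> c = 0"
    using \<open>m > 0\<close> AB(3) AB'(3)
    by (metis carrier_matD(2) index_mult_mat_vec index_transpose_mat(2) index_zero_vec(1)
        row_transpose)+
  then have "(\<Sum>h\<in>{0..<n}. B $$ (h, 0) * c $ h) = (\<Sum>h\<in>{0..<n}. B' $$ (h, 0) * c $ h)"
    using AB(3) AB'(3) c(1) \<open>m > 0\<close> by (simp add: scalar_prod_def)
  moreover have "(\<Sum>h\<in>{0..<n} - {i}. B $$ (h, 0) * c $ h)
      = (\<Sum>h\<in>{0..<n} - {i}. B' $$ (h, 0) * c $ h)"
    using offpos \<open>m > 0\<close> by (intro sum.cong) auto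
  ultimately have "B $$ (i, 0) * c $ i = B' $$ (i, 0) * c $ i"
    using i by (simp add: sum.remove[of "{0..<n}" i])
  with c(3) have atpos: "B $$ (i, 0) = B' $$ (i, 0)"
    by simp
  have "B = B'"
  proof (rule eq_matI)
    fix h j assume "h < dim_row B'" "j < dim_col B'"
    then show "B $$ (h, j) = B' $$ (h, j)"
      using offpos[of h j] atpos AB'(3) by (cases "(h, j) = (i, 0)") auto
  qed (use AB AB' in auto)
  with A show "v = w"
    by (simp add: AB(1) AB'(1))
qed

section \<open>Overdetermined systems are negligible\<close>

theorem corollary3p3:
  fixes m k n :: nat
  assumes "m > 0" and "k > 0" and "n > 0"
    and "n > k"
  shows "asymp_negligible (n * (k + m)) (SAT m k n)"
proof (rule asymp_negligible_Union_coord_determined)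
  show "n * (k + m) > 0" "finite {..<n}"
    using assms by auto
  show "SAT m k n \<subseteq> (\<Union>i<n. SAT_part m k n i)"
    using \<open>n > k\<close> by (rule SAT_subset_Union_SAT_part)
  fix i assume "i \<in> {..<n}"
  then have i: "i < n" by simp
  show "i * (k + m) + k < n * (k + m)"
    using index_vec_of_augmented(1)[of "0\<^sub>m n k" n k "0\<^sub>m n m" m i k] i \<open>m > 0\<close> by simp
  show "SAT_part m k n i \<subseteq> carrier_vec (n * (k + m))"
    by (rule SAT_part_subset)
  show "coord_determined (i * (k + m) + k) (SAT_part m k n i)"
    using \<open>m > 0\<close> i by (rule coord_determined_SAT_part)
qed

end
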